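(* Rack coverings are the same as central extensions of racks: a surjective morphism of racks $f\colon A\to B$ is a covering if and only if it is a central extension.
   Context: A rack is a set $X$ with two binary operations $\triangleleft,\triangleleft^{-1}$ such that $(x\triangleleft y)\triangleleft^{-1}y = x = (x\triangleleft^{-1}y)\triangleleft y$ and $(x\triangleleft y)\triangleleft z=(x\triangleleft z)\triangleleft(y\triangleleft z)$ for all $x,y,z$. Morphisms are maps preserving the operations. An extension is a surjective morphism. Covering: a surjective morphism $f\colon A\to B$ such that $(x\triangleleft a)\triangleleft^{-1} b = x$ for all $x\in A$ and all $a,b\in A$ with $f(a)=f(b)$. $\pi_0(X)$ denotes the set of connected components of $X$, i.e. the quotient of the set $X$ by the equivalence relation generated by the pairs $(x,x\triangleleft y)$, and $\eta_X\colon X\to\pi_0(X)$ is the quotient map; sets are regarded as trivial racks ($x\triangleleft y=x$), and $\pi_0$ is left adjoint to the inclusion of sets into racks with unit $\eta$. Trivial extension: an extension $t\colon X\to Y$ for which the square $\eta_Y\circ t=\pi_0(t)\circ\eta_X$ is a pullback. Central extension: an extension $f\colon A\to B$ for which there is an extension $e\colon E\to B$ such that the pullback $E\times_BA\to E$ of $f$ along $e$ is a trivial extension. *)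

theory Defs
  imports Main "HOL-Library.FuncSet"
begin

text \<open>Racks are given on carrier sets rather than on whole types, so that the empty rack, pullbacks
  and sets of connected components are all covered. The operations are unconstrained off the
  carrier, and maps are only compared on it.\<close>

record 'a rack =
  carrier :: "'a set"
  rack_op :: "'a \<Rightarrow> 'a \<Rightarrow> 'a" (infixl "\<triangleleft>\<index>" 70)
  rack_inv_op :: "'a \<Rightarrow> 'a \<Rightarrow> 'a" (infixl "\<triangleleft>\<^sup>-\<index>" 70)

locale rack =
  fixes X :: "'a rack" (structure)
  assumes op_closed: "\<lbrakk>x \<in> carrier X; y \<in> carrier X\<rbrakk> \<Longrightarrow> x \<triangleleft> y \<in> carrier X"
    and inv_op_closed: "\<lbrakk>x \<in> carrier X; y \<in> carrier X\<rbrakk> \<Longrightarrow> x \<triangleleft>\<^sup>- y \<in> carrier X"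
    and op_inv_op: "\<lbrakk>x \<in> carrier X; y \<in> carrier X\<rbrakk> \<Longrightarrow> (x \<triangleleft> y) \<triangleleft>\<^sup>- y = x"
    and inv_op_op: "\<lbrakk>x \<in> carrier X; y \<in> carrier X\<rbrakk> \<Longrightarrow> (x \<triangleleft>\<^sup>- y) \<triangleleft> y = x"
    and self_distrib: "\<lbrakk>x \<in> carrier X; y \<in> carrier X; z \<in> carrier X\<rbrakk>
      \<Longrightarrow> (x \<triangleleft> y) \<triangleleft> z = (x \<triangleleft> z) \<triangleleft> (y \<triangleleft> z)"

definition rack_hom :: "'a rack \<Rightarrow> 'b rack \<Rightarrow> ('a \<Rightarrow> 'b) set" where
  "rack_hom X Y = {f \<in> carrier X \<rightarrow> carrier Y. \<forall>x\<in>carrier X. \<forall>y\<in>carrier X.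
     f (x \<triangleleft>\<^bsub>X\<^esub> y) = f x \<triangleleft>\<^bsub>Y\<^esub> f y \<and> f (x \<triangleleft>\<^sup>-\<^bsub>X\<^esub> y) = f x \<triangleleft>\<^sup>-\<^bsub>Y\<^esub> f y}"

definition rack_iso :: "'a rack \<Rightarrow> 'b rack \<Rightarrow> ('a \<Rightarrow> 'b) set" where
  "rack_iso X Y = {f \<in> rack_hom X Y. \<exists>g\<in>rack_hom Y X.
     (\<forall>x\<in>carrier X. g (f x) = x) \<and> (\<forall>y\<in>carrier Y. f (g y) = y)}"

definition rack_extension :: "'a rack \<Rightarrow> 'b rack \<Rightarrow> ('a \<Rightarrow> 'b) \<Rightarrow> bool" where
  "rack_extension A B f \<longleftrightarrow> f \<in> rack_hom A B \<and> f ` carrier A = carrier B"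

definition rack_covering :: "'a rack \<Rightarrow> 'b rack \<Rightarrow> ('a \<Rightarrow> 'b) \<Rightarrow> bool" where
  "rack_covering A B f \<longleftrightarrow> rack_extension A B f \<and>
     (\<forall>x\<in>carrier A. \<forall>a\<in>carrier A. \<forall>b\<in>carrier A.
        f a = f b \<longrightarrow> (x \<triangleleft>\<^bsub>A\<^esub> a) \<triangleleft>\<^sup>-\<^bsub>A\<^esub> b = x)"

definition trivial_rack :: "'a set \<Rightarrow> 'a rack" where
  "trivial_rack S = \<lparr>carrier = S, rack_op = (\<lambda>x y. x), rack_inv_op = (\<lambda>x y. x)\<rparr>"

definition component_rel :: "'a rack \<Rightarrow> ('a \<times> 'a) set" where
  "component_rel X = {(x, y). x \<in> carrier X \<and> y \<in> carrier X \<and>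
     equivclp (\<lambda>u v. u \<in> carrier X \<and> (\<exists>w\<in>carrier X. v = u \<triangleleft>\<^bsub>X\<^esub> w)) x y}"

definition pi0 :: "'a rack \<Rightarrow> 'a set rack" where
  "pi0 X = trivial_rack (carrier X // component_rel X)"

definition eta :: "'a rack \<Rightarrow> 'a \<Rightarrow> 'a set" where
  "eta X x = component_rel X `` {x}"

text \<open>For a morphism \<open>t\<close>, the component of \<open>x\<close> is sent to the component of \<open>t x\<close>; see
  \<open>pi0_map_eta\<close> below.\<close>

definition pi0_map :: "'a rack \<Rightarrow> 'b rack \<Rightarrow> ('a \<Rightarrow> 'b) \<Rightarrow> 'a set \<Rightarrow> 'b set" where
  "pi0_map X Y t C = component_rel Y `` (t ` C)"

definition rack_pullback ::
  "'y rack \<Rightarrow> 'p rack \<Rightarrow> ('y \<Rightarrow> 'z) \<Rightarrow> ('p \<Rightarrow> 'z) \<Rightarrow> ('y \<times> 'p) rack" where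
  "rack_pullback Y P g h =
     \<lparr>carrier = {(y, p). y \<in> carrier Y \<and> p \<in> carrier P \<and> g y = h p},
      rack_op = (\<lambda>(y, p) (y', p'). (y \<triangleleft>\<^bsub>Y\<^esub> y', p \<triangleleft>\<^bsub>P\<^esub> p')),
      rack_inv_op = (\<lambda>(y, p) (y', p'). (y \<triangleleft>\<^sup>-\<^bsub>Y\<^esub> y', p \<triangleleft>\<^sup>-\<^bsub>P\<^esub> p'))\<rparr>"

text \<open>The square

        X --q--> P
        |        |
        t        h
        v        v
        Y --g--> Z

  is a pullback of racks. A universal property would have to quantify over test racks in all types,
  so this is phrased through the comparison map into the concrete pullback; the universal property is
  derived in \<open>pullback_square_universal\<close>.\<close>

definition pullback_square ::
  "'x rack \<Rightarrow> 'p rack \<Rightarrow> 'y rack \<Rightarrow> 'z rack \<Rightarrow>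
     ('x \<Rightarrow> 'p) \<Rightarrow> ('x \<Rightarrow> 'y) \<Rightarrow> ('p \<Rightarrow> 'z) \<Rightarrow> ('y \<Rightarrow> 'z) \<Rightarrow> bool" where
  "pullback_square X P Y Z q t h g \<longleftrightarrow>
     q \<in> rack_hom X P \<and> t \<in> rack_hom X Y \<and> h \<in> rack_hom P Z \<and> g \<in> rack_hom Y Z \<and>
     (\<forall>x\<in>carrier X. g (t x) = h (q x)) \<and>
     (\<lambda>x. (t x, q x)) \<in> rack_iso X (rack_pullback Y P g h)"

definition trivial_extension :: "'x rack \<Rightarrow> 'y rack \<Rightarrow> ('x \<Rightarrow> 'y) \<Rightarrow> bool" where
  "trivial_extension X Y t \<longleftrightarrow> rack_extension X Y t \<and>
     pullback_square X (pi0 X) Y (pi0 Y) (eta X) t (pi0_map X Y t) (eta Y)"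

text \<open>HOL cannot quantify over the type in which the elements of \<open>E\<close> live, so this type is a
  parameter: \<open>central_extension TYPE('e) A B f\<close> says that \<open>f\<close> becomes trivial after pullback along
  some extension whose domain is a rack on a subset of \<open>'e\<close>. The choice \<open>'b list\<close>, for \<open>B\<close> with
  elements in \<open>'b\<close>, is as good as any: it has room for the free rack on the carrier of \<open>B\<close>
  (indeed for every rack of cardinality at most that of \<open>'b\<close> or countable), and an extension
  witnessing centrality can always be replaced by the subrack of \<open>E\<close> generated by a section of \<open>e\<close>.\<close>

definition central_extension ::
  "'e itself \<Rightarrow> 'a rack \<Rightarrow> 'b rack \<Rightarrow> ('a \<Rightarrow> 'b) \<Rightarrow> bool" where
  "central_extension (_ :: 'e itself) A B f \<longleftrightarrow> rack_extension A B f \<and>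
     (\<exists>(E :: 'e rack) e. rack E \<and> rack_extension E B e \<and>
        trivial_extension (rack_pullback E A e f) E fst)"

lemma rack_pullback_is_rack:
  assumes "rack Y" "rack P" "g \<in> rack_hom Y Z" "h \<in> rack_hom P Z"
  shows "rack (rack_pullback Y P g h)"
proof -
  interpret Y: rack Y by fact
  interpret P: rack P by fact
  have "g (x \<triangleleft>\<^bsub>Y\<^esub> y) = g x \<triangleleft>\<^bsub>Z\<^esub> g y" "g (x \<triangleleft>\<^sup>-\<^bsub>Y\<^esub> y) = g x \<triangleleft>\<^sup>-\<^bsub>Z\<^esub> g y"
    if "x \<in> carrier Y" "y \<in> carrier Y" for x y
    using assms(3) that by (auto simp: rack_hom_def)
  moreover have "h (x \<triangleleft>\<^bsub>P\<^esub> y) = h x \<triangleleft>\<^bsub>Z\<^esub> h y" "h (x \<triangleleft>\<^sup>-\<^bsub>P\<^esub> y) = h x \<triangleleft>\<^sup>-\<^bsub>Z\<^esub> h y"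
    if "x \<in> carrier P" "y \<in> carrier P" for x y
    using assms(4) that by (auto simp: rack_hom_def)
  ultimately show ?thesis
    by unfold_locales
      (auto simp: rack_pullback_def Y.op_closed Y.inv_op_closed Y.op_inv_op Y.inv_op_op
        P.op_closed P.inv_op_closed P.op_inv_op P.inv_op_op intro: Y.self_distrib P.self_distrib)
qed

lemma pi0_map_eta:
  assumes "t \<in> rack_hom X Y" "x \<in> carrier X"
  shows "pi0_map X Y t (eta X x) = eta Y (t x)"
proof -
  define R where "R = (\<lambda>u v. u \<in> carrier X \<and> (\<exists>w\<in>carrier X. v = u \<triangleleft>\<^bsub>X\<^esub> w))"
  define S where "S = (\<lambda>u v. u \<in> carrier Y \<and> (\<exists>w\<in>carrier Y. v = u \<triangleleft>\<^bsub>Y\<^esub> w))"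
  have relX: "(u, v) \<in> component_rel X \<longleftrightarrow> u \<in> carrier X \<and> v \<in> carrier X \<and> equivclp R u v" for u v
    by (simp add: component_rel_def R_def)
  have relY: "(u, v) \<in> component_rel Y \<longleftrightarrow> u \<in> carrier Y \<and> v \<in> carrier Y \<and> equivclp S u v" for u v
    by (simp add: component_rel_def S_def)
  have step: "S (t u) (t v)" if "R u v" for u v
    using that assms(1) unfolding R_def S_def rack_hom_def by (auto simp: Pi_iff)
  have map: "equivclp S (t u) (t v)" if "equivclp R u v" for u v
    using that
  proof (induction rule: equivclp_induct)
    case base
    show ?case by (rule equivclp_refl)
  next
    case (step y z)
    then have "S (t y) (t z) \<or> S (t z) (t y)"
      using \<open>\<And>u v. R u v \<Longrightarrow> S (t u) (t v)\<close> by blast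
    with step.IH show ?case by (rule equivclp_into_equivclp)
  qed
  have maps: "t u \<in> carrier Y" if "u \<in> carrier X" for u
    using that assms(1) by (auto simp: rack_hom_def)
  have "y \<in> pi0_map X Y t (eta X x) \<longleftrightarrow> y \<in> eta Y (t x)" for y
  proof
    assume "y \<in> pi0_map X Y t (eta X x)"
    then obtain u where "(x, u) \<in> component_rel X" and u: "(t u, y) \<in> component_rel Y"
      by (auto simp: pi0_map_def eta_def)
    then have "equivclp S (t x) (t u)"
      using map by (simp add: relX)
    then have "(t x, y) \<in> component_rel Y"
      using u maps[OF assms(2)] equivclp_trans[of S "t x" "t u" y] by (simp add: relY)
    then show "y \<in> eta Y (t x)"
      by (simp add: eta_def)
  next
    assume "y \<in> eta Y (t x)"
    then have y: "(t x, y) \<in> component_rel Y"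
      by (simp add: eta_def)
    have "(x, x) \<in> component_rel X"
      using assms(2) by (simp add: relX)
    then show "y \<in> pi0_map X Y t (eta X x)"
      unfolding pi0_map_def eta_def
      by (intro ImageI[OF y] imageI) simp
  qed
  then show ?thesis
    by (rule set_eqI)
qed

lemma pullback_square_universal:
  assumes "pullback_square X P Y Z q t h g"
    and "u \<in> rack_hom W Y" "v \<in> rack_hom W P" "\<forall>w\<in>carrier W. g (u w) = h (v w)"
  shows "\<exists>k\<in>rack_hom W X. (\<forall>w\<in>carrier W. t (k w) = u w \<and> q (k w) = v w) \<and>
    (\<forall>k'\<in>rack_hom W X. (\<forall>w\<in>carrier W. t (k' w) = u w \<and> q (k' w) = v w) \<longrightarrow>
       (\<forall>w\<in>carrier W. k' w = k w))"
proof -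
  let ?L = "rack_pullback Y P g h"
  obtain m where m: "m \<in> rack_hom ?L X" "\<forall>x\<in>carrier X. m (t x, q x) = x"
    "\<forall>y\<in>carrier ?L. (t (m y), q (m y)) = y"
    using assms(1) unfolding pullback_square_def rack_iso_def by auto
  have uv: "(\<lambda>w. (u w, v w)) \<in> rack_hom W ?L"
    using assms(2-4) by (auto simp: rack_hom_def rack_pullback_def)
  have L: "(u w, v w) \<in> carrier ?L" if "w \<in> carrier W" for w
    using uv that by (auto simp: rack_hom_def)
  have "(\<lambda>w. m (u w, v w)) \<in> rack_hom W X"
    using uv m(1) unfolding rack_hom_def by (auto simp: Pi_iff)
  moreover have "t (m (u w, v w)) = u w \<and> q (m (u w, v w)) = v w" if "w \<in> carrier W" for w
    using m(3) L[OF that] by auto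
  moreover have "k' w = m (u w, v w)"
    if "k' \<in> rack_hom W X" "\<forall>w\<in>carrier W. t (k' w) = u w \<and> q (k' w) = v w" "w \<in> carrier W" for k' w
  proof -
    have "k' w \<in> carrier X" using that by (auto simp: rack_hom_def)
    then show ?thesis using m(2) that by force
  qed
  ultimately show ?thesis by (intro bexI[of _ "\<lambda>w. m (u w, v w)"]) blast+
qed

end

theory Submission
  imports Defs "HOL-Library.Countable"
begin

text \<open>For a morphism \<open>t: X \<rightarrow> Y\<close> that is onto, components of \<open>Y\<close> are reached by lifting paths, so the
  comparison map of the square that defines a trivial extension is always onto; hence \<open>t\<close> is trivial
  exactly when an element of \<open>X\<close> is determined by its image and its component
  (\<open>trivial_extension_iff_inj_on\<close>).

  Central extensions are coverings: let \<open>E \<times>\<^sub>B A \<rightarrow> E\<close> be trivial and \<open>f a = f b\<close>, and let \<open>u\<close> and \<open>v\<close>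
  in \<open>E\<close> lie over \<open>f x\<close> and \<open>f a\<close>. Acting on \<open>(u, x)\<close> by \<open>(v, a)\<close> and then inversely by \<open>(v, b)\<close>
  stays in the component and does not move \<open>u\<close>, so it does not move \<open>x\<close> either.

  Coverings are central: choose a section \<open>\<sigma>\<close> of \<open>f\<close>. Let \<open>E\<close> consist of the pairs \<open>(c, g)\<close> with \<open>c\<close>
  in \<open>B\<close> and \<open>g\<close> an inner automorphism of \<open>A\<close>, thought of as the point \<open>g (\<sigma> c)\<close> of \<open>A\<close> together with
  the way in which it was reached from \<open>\<sigma> c\<close>; the operation moves points as in \<open>A\<close> and records the
  move in \<open>g\<close>. This \<open>E\<close> is the quotient of the free rack on \<open>B\<close> in which two elements are identified
  when they have the same base point and act in the same way on \<open>A\<close>. Over \<open>E\<close> the covering becomes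
  trivial: on the pullback the element \<open>g\<^sup>-\<^sup>1 a\<close> attached to \<open>((c, g), a)\<close> does not change along
  paths, because two elements of one fibre of \<open>f\<close> act equally on \<open>A\<close>, so that \<open>g\<close> and \<open>a\<close> are moved by
  the same map (\<open>rack_covering_split_by_inner_rack\<close>). For the same reason the inner automorphisms are
  words in the elements of \<open>B\<close> and their inverses, so the elements of \<open>E\<close> can be encoded as lists over
  the type of the elements of \<open>B\<close>.\<close>


section \<open>Morphisms and pullbacks\<close>

lemma rack_homD:
  assumes "f \<in> rack_hom X Y" "x \<in> carrier X"
  shows "f x \<in> carrier Y"
    and "y \<in> carrier X \<Longrightarrow> f (x \<triangleleft>\<^bsub>X\<^esub> y) = f x \<triangleleft>\<^bsub>Y\<^esub> f y"
    and "y \<in> carrier X \<Longrightarrow> f (x \<triangleleft>\<^sup>-\<^bsub>X\<^esub> y) = f x \<triangleleft>\<^sup>-\<^bsub>Y\<^esub> f y"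
  using assms by (auto simp: rack_hom_def)

lemma rack_homI:
  assumes "\<And>x. x \<in> carrier X \<Longrightarrow> f x \<in> carrier Y"
    and "\<And>x y. x \<in> carrier X \<Longrightarrow> y \<in> carrier X \<Longrightarrow> f (x \<triangleleft>\<^bsub>X\<^esub> y) = f x \<triangleleft>\<^bsub>Y\<^esub> f y"
    and "\<And>x y. x \<in> carrier X \<Longrightarrow> y \<in> carrier X \<Longrightarrow> f (x \<triangleleft>\<^sup>-\<^bsub>X\<^esub> y) = f x \<triangleleft>\<^sup>-\<^bsub>Y\<^esub> f y"
  shows "f \<in> rack_hom X Y"
  using assms by (auto simp: rack_hom_def)

lemma rack_hom_comp:
  assumes "f \<in> rack_hom X Y" "g \<in> rack_hom Y Z"
  shows "(\<lambda>x. g (f x)) \<in> rack_hom X Z"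
  by (rule rack_homI) (simp_all add: rack_homD[OF assms(1)] rack_homD[OF assms(2)])

lemma bij_betw_rack_hom_imp_iso:
  assumes "rack X" "f \<in> rack_hom X Y" "bij_betw f (carrier X) (carrier Y)"
  shows "f \<in> rack_iso X Y"
proof -
  interpret X: rack X by fact
  let ?g = "inv_into (carrier X) f"
  have g: "?g y \<in> carrier X" "f (?g y) = y" if "y \<in> carrier Y" for y
    using that assms(3) by (auto simp: bij_betw_def inv_into_into f_inv_into_f)
  have gf: "?g (f x) = x" if "x \<in> carrier X" for x
    using that assms(3) by (simp add: bij_betw_def)
  have "?g \<in> rack_hom Y X"
  proof (rule rack_homI)
    fix x y assume xy: "x \<in> carrier Y" "y \<in> carrier Y"
    show "?g (x \<triangleleft>\<^bsub>Y\<^esub> y) = ?g x \<triangleleft>\<^bsub>X\<^esub> ?g y"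
      using gf[of "?g x \<triangleleft>\<^bsub>X\<^esub> ?g y"] xy by (simp add: g X.op_closed rack_homD(2)[OF assms(2)])
    show "?g (x \<triangleleft>\<^sup>-\<^bsub>Y\<^esub> y) = ?g x \<triangleleft>\<^sup>-\<^bsub>X\<^esub> ?g y"
      using gf[of "?g x \<triangleleft>\<^sup>-\<^bsub>X\<^esub> ?g y"] xy by (simp add: g X.inv_op_closed rack_homD(3)[OF assms(2)])
  qed (rule g)
  then show ?thesis
    using assms(2) g gf unfolding rack_iso_def by blast
qed

lemma rack_pullback_simps [simp]:
  "(y, p) \<in> carrier (rack_pullback Y P g h) \<longleftrightarrow> y \<in> carrier Y \<and> p \<in> carrier P \<and> g y = h p"
  "(y, p) \<triangleleft>\<^bsub>rack_pullback Y P g h\<^esub> (y', p') = (y \<triangleleft>\<^bsub>Y\<^esub> y', p \<triangleleft>\<^bsub>P\<^esub> p')"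
  "(y, p) \<triangleleft>\<^sup>-\<^bsub>rack_pullback Y P g h\<^esub> (y', p') = (y \<triangleleft>\<^sup>-\<^bsub>Y\<^esub> y', p \<triangleleft>\<^sup>-\<^bsub>P\<^esub> p')"
  by (simp_all add: rack_pullback_def)

lemma fst_rack_extension_pullback:
  assumes "e \<in> rack_hom E B" "rack_extension A B f"
  shows "rack_extension (rack_pullback E A e f) E fst"
proof -
  have "fst ` carrier (rack_pullback E A e f) = carrier E"
  proof (intro equalityI subsetI)
    fix y assume y: "y \<in> carrier E"
    have "e y \<in> f ` carrier A"
      using rack_homD(1)[OF assms(1) y] assms(2) by (simp add: rack_extension_def)
    then obtain a where "a \<in> carrier A" "f a = e y"
      by (metis imageE)
    with y have "(y, a) \<in> carrier (rack_pullback E A e f)"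
      by simp
    then show "y \<in> fst ` carrier (rack_pullback E A e f)"
      by (rule image_eqI[rotated]) simp
  qed auto
  then show ?thesis
    by (auto simp: rack_extension_def intro!: rack_homI)
qed


section \<open>Connected components\<close>

lemma equiv_component_rel: "equiv (carrier X) (component_rel X)"
  unfolding component_rel_def
  by (rule equivI)
    (auto simp: refl_on_def sym_def trans_def intro: equivclp_refl equivclp_sym equivclp_trans)

lemma eta_eq_iff:
  assumes "x \<in> carrier X" "y \<in> carrier X"
  shows "eta X x = eta X y \<longleftrightarrow> (x, y) \<in> component_rel X"
  unfolding eta_def using eq_equiv_class_iff[OF equiv_component_rel assms] .

lemma carrier_pi0: "carrier (pi0 X) = eta X ` carrier X"
  by (auto simp: pi0_def trivial_rack_def eta_def quotient_def)

lemma pi0_ops [simp]: "C \<triangleleft>\<^bsub>pi0 X\<^esub> D = C" "C \<triangleleft>\<^sup>-\<^bsub>pi0 X\<^esub> D = C"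
  by (simp_all add: pi0_def trivial_rack_def)

lemma component_rel_induct [consumes 1, case_names base forward backward]:
  assumes "(x, y) \<in> component_rel X"
    and "P x"
    and "\<And>y w. \<lbrakk>y \<in> carrier X; w \<in> carrier X; P y\<rbrakk> \<Longrightarrow> P (y \<triangleleft>\<^bsub>X\<^esub> w)"
    and "\<And>y w. \<lbrakk>y \<in> carrier X; w \<in> carrier X; P (y \<triangleleft>\<^bsub>X\<^esub> w)\<rbrakk> \<Longrightarrow> P y"
  shows "P y"
proof -
  have "equivclp (\<lambda>u v. u \<in> carrier X \<and> (\<exists>w\<in>carrier X. v = u \<triangleleft>\<^bsub>X\<^esub> w)) x y"
    using assms(1) by (simp add: component_rel_def)
  then show ?thesis
    by (induction rule: equivclp_induct) (use assms(2-) in blast)+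
qed

lemma (in rack) eta_op:
  assumes "x \<in> carrier X" "y \<in> carrier X"
  shows "eta X (x \<triangleleft> y) = eta X x"
proof -
  have "(x, x \<triangleleft> y) \<in> component_rel X"
    using assms by (auto simp: component_rel_def op_closed intro!: r_into_equivclp)
  then show ?thesis
    using assms by (simp add: eta_eq_iff[symmetric] op_closed)
qed

lemma (in rack) eta_inv_op:
  assumes "x \<in> carrier X" "y \<in> carrier X"
  shows "eta X (x \<triangleleft>\<^sup>- y) = eta X x"
  using eta_op[of "x \<triangleleft>\<^sup>- y" y] assms by (simp add: inv_op_closed inv_op_op)

lemma (in rack) eta_rack_hom: "eta X \<in> rack_hom X (pi0 X)"
  by (rule rack_homI) (simp_all add: carrier_pi0 eta_op eta_inv_op)

lemma pi0_map_rack_hom: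
  assumes "t \<in> rack_hom X Y"
  shows "pi0_map X Y t \<in> rack_hom (pi0 X) (pi0 Y)"
  by (rule rack_homI) (auto simp: carrier_pi0 pi0_map_eta[OF assms] rack_homD(1)[OF assms])

lemma rack_hom_eta_eq:
  assumes "t \<in> rack_hom X Y" "x \<in> carrier X" "x' \<in> carrier X" "eta X x = eta X x'"
  shows "eta Y (t x) = eta Y (t x')"
  by (metis assms pi0_map_eta)

text \<open>Paths lift along surjective morphisms: each single step \<open>y \<mapsto> y \<triangleleft> w\<close> or \<open>y \<mapsto> y \<triangleleft>\<^sup>- w\<close> is
  imitated upstairs after choosing a preimage of \<open>w\<close>.\<close>

lemma component_lift:
  assumes "rack X" "rack Y" "rack_extension X Y t" "x \<in> carrier X"
    and "(t x, y) \<in> component_rel Y"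
  shows "\<exists>x'\<in>carrier X. t x' = y \<and> eta X x' = eta X x"
proof -
  interpret X: rack X by fact
  interpret Y: rack Y by fact
  have t: "t \<in> rack_hom X Y" "t ` carrier X = carrier Y"
    using assms(3) by (auto simp: rack_extension_def)
  show ?thesis using assms(5)
  proof (induction rule: component_rel_induct)
    case base
    show ?case using assms(4) by blast
  next
    case (forward y w)
    then obtain x' w' where "x' \<in> carrier X" "w' \<in> carrier X" "t x' = y" "t w' = w"
      "eta X x' = eta X x"
      using t(2) by (metis imageE)
    then show ?case
      by (intro bexI[of _ "x' \<triangleleft>\<^bsub>X\<^esub> w'"]) (simp_all add: rack_homD[OF t(1)] X.eta_op X.op_closed)
  next
    case (backward y w)
    then obtain x' w' where "x' \<in> carrier X" "w' \<in> carrier X" "t x' = y \<triangleleft>\<^bsub>Y\<^esub> w" "t w' = w"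
      "eta X x' = eta X x"
      using t(2) by (metis imageE)
    then show ?case using backward(1,2)
      by (intro bexI[of _ "x' \<triangleleft>\<^sup>-\<^bsub>X\<^esub> w'"])
        (simp_all add: rack_homD[OF t(1)] X.eta_inv_op X.inv_op_closed Y.op_inv_op)
  qed
qed


section \<open>Trivial extensions\<close>

text \<open>Injectivity is the only content of triviality: the comparison map into the pullback is onto by
  \<open>component_lift\<close>, and a bijective morphism is an isomorphism.\<close>

lemma trivial_extension_iff_inj_on:
  assumes "rack X" "rack Y" "rack_extension X Y t"
  shows "trivial_extension X Y t \<longleftrightarrow> inj_on (\<lambda>x. (t x, eta X x)) (carrier X)"
proof
  assume "trivial_extension X Y t"
  then obtain g where "\<forall>x\<in>carrier X. g (t x, eta X x) = x"
    unfolding trivial_extension_def pullback_square_def rack_iso_def by blast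
  then show "inj_on (\<lambda>x. (t x, eta X x)) (carrier X)"
    by (intro inj_on_inverseI[of _ g]) simp
next
  assume inj: "inj_on (\<lambda>x. (t x, eta X x)) (carrier X)"
  interpret X: rack X by fact
  interpret Y: rack Y by fact
  have t: "t \<in> rack_hom X Y" "t ` carrier X = carrier Y"
    using assms(3) by (auto simp: rack_extension_def)
  let ?P = "rack_pullback Y (pi0 X) (eta Y) (pi0_map X Y t)"
  have "(\<lambda>x. (t x, eta X x)) \<in> rack_hom X ?P"
    by (rule rack_homI)
      (simp_all add: rack_homD[OF t(1)] pi0_map_eta[OF t(1)] carrier_pi0 X.eta_op X.eta_inv_op)
  moreover have "(\<lambda>x. (t x, eta X x)) ` carrier X = carrier ?P"
  proof (intro equalityI subsetI)
    fix p assume "p \<in> carrier ?P"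
    then obtain y x where p: "p = (y, eta X x)" "y \<in> carrier Y" "x \<in> carrier X"
      "eta Y y = eta Y (t x)"
      by (cases p) (auto simp: carrier_pi0 pi0_map_eta[OF t(1)])
    then have "(t x, y) \<in> component_rel Y"
      using eta_eq_iff[of "t x" Y y] by (simp add: rack_homD(1)[OF t(1)])
    then obtain x' where "x' \<in> carrier X" "t x' = y" "eta X x' = eta X x"
      using component_lift[OF assms p(3)] by blast
    then show "p \<in> (\<lambda>x. (t x, eta X x)) ` carrier X"
      by (intro image_eqI[of _ _ x']) (simp_all add: p(1))
  qed (auto simp: rack_homD(1)[OF t(1)] pi0_map_eta[OF t(1)] carrier_pi0)
  ultimately have "(\<lambda>x. (t x, eta X x)) \<in> rack_iso X ?P"
    using inj by (intro bij_betw_rack_hom_imp_iso[OF assms(1)]) (auto simp: bij_betw_def)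
  then show "trivial_extension X Y t"
    using assms(3) t(1) X.eta_rack_hom Y.eta_rack_hom pi0_map_rack_hom[OF t(1)]
    by (simp add: trivial_extension_def pullback_square_def pi0_map_eta[OF t(1)])
qed

lemma trivial_extension_pullback_iff:
  assumes "rack A" "rack E" "rack_extension A B f" "rack_extension E B e"
  defines "P \<equiv> rack_pullback E A e f"
  shows "trivial_extension P E fst \<longleftrightarrow>
    (\<forall>y a b. (y, a) \<in> carrier P \<longrightarrow> (y, b) \<in> carrier P \<longrightarrow> eta P (y, a) = eta P (y, b) \<longrightarrow> a = b)"
proof -
  have "rack P" "rack_extension P E fst"
    using assms rack_pullback_is_rack[of E A e B f] fst_rack_extension_pullback[of e E B A f]
    by (simp_all add: rack_extension_def)
  then have "trivial_extension P E fst \<longleftrightarrow> inj_on (\<lambda>x. (fst x, eta P x)) (carrier P)"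
    using assms(2) by (intro trivial_extension_iff_inj_on)
  also have "\<dots> \<longleftrightarrow>
    (\<forall>y a b. (y, a) \<in> carrier P \<longrightarrow> (y, b) \<in> carrier P \<longrightarrow> eta P (y, a) = eta P (y, b) \<longrightarrow> a = b)"
    (is "_ \<longleftrightarrow> ?R")
  proof
    assume inj: "inj_on (\<lambda>x. (fst x, eta P x)) (carrier P)"
    show ?R
    proof (intro allI impI)
      fix y a b
      assume "(y, a) \<in> carrier P" "(y, b) \<in> carrier P" "eta P (y, a) = eta P (y, b)"
      then show "a = b"
        using inj_onD[OF inj, of "(y, a)" "(y, b)"] by simp
    qed
  next
    assume R: ?R
    show "inj_on (\<lambda>x. (fst x, eta P x)) (carrier P)"
    proof (rule inj_onI)
      fix p q
      assume pq: "p \<in> carrier P" "q \<in> carrier P" "(fst p, eta P p) = (fst q, eta P q)"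
      obtain y a b where "p = (y, a)" "q = (y, b)"
        using pq(3) by (cases p; cases q) simp
      with R pq show "p = q"
        by blast
    qed
  qed
  finally show ?thesis .
qed

text \<open>Acting by \<open>(v, a)\<close> and then inversely by \<open>(v, b)\<close> is a path in the pullback that is closed in
  \<open>E\<close>; triviality forces it to be closed in \<open>A\<close>.\<close>

lemma central_extension_imp_rack_covering:
  assumes "rack A" "central_extension TYPE('e) A B f"
  shows "rack_covering A B f"
proof -
  interpret A: rack A by fact
  obtain E :: "'e rack" and e where E: "rack E" "rack_extension E B e"
    and triv: "trivial_extension (rack_pullback E A e f) E fst" and f: "rack_extension A B f"
    using assms(2) by (auto simp: central_extension_def)
  interpret E: rack E by fact
  let ?P = "rack_pullback E A e f"
  interpret P: rack ?P
    using E f by (auto simp: rack_extension_def intro: rack_pullback_is_rack assms(1))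
  have "(x \<triangleleft>\<^bsub>A\<^esub> a) \<triangleleft>\<^sup>-\<^bsub>A\<^esub> b = x"
    if "x \<in> carrier A" "a \<in> carrier A" "b \<in> carrier A" "f a = f b" for x a b
  proof -
    have "f x \<in> e ` carrier E" "f a \<in> e ` carrier E"
      using E(2) f that(1,2) by (auto simp: rack_extension_def rack_homD(1))
    then obtain u v where "u \<in> carrier E" "v \<in> carrier E" "e u = f x" "e v = f a"
      by (metis imageE)
    then have P: "(u, x) \<in> carrier ?P" "(v, a) \<in> carrier ?P" "(v, b) \<in> carrier ?P"
      using that by simp_all
    let ?p = "((u, x) \<triangleleft>\<^bsub>?P\<^esub> (v, a)) \<triangleleft>\<^sup>-\<^bsub>?P\<^esub> (v, b)"
    have "?p = (u, (x \<triangleleft>\<^bsub>A\<^esub> a) \<triangleleft>\<^sup>-\<^bsub>A\<^esub> b)"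
      using \<open>u \<in> carrier E\<close> \<open>v \<in> carrier E\<close> by (simp add: E.op_inv_op)
    moreover have "?p \<in> carrier ?P" "eta ?P ?p = eta ?P (u, x)"
      using P by (simp_all only: P.op_closed P.inv_op_closed P.eta_op P.eta_inv_op)
    ultimately have "(u, (x \<triangleleft>\<^bsub>A\<^esub> a) \<triangleleft>\<^sup>-\<^bsub>A\<^esub> b) \<in> carrier ?P"
      "eta ?P (u, (x \<triangleleft>\<^bsub>A\<^esub> a) \<triangleleft>\<^sup>-\<^bsub>A\<^esub> b) = eta ?P (u, x)"
      by (simp_all only:)
    with triv[unfolded trivial_extension_pullback_iff[OF assms(1) E(1) f E(2)]] P(1)
    show ?thesis
      by blast
  qed
  then show ?thesis
    using f by (simp add: rack_covering_def)
qed


section \<open>Change of the type of a splitting extension\<close>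

text \<open>This makes \<open>j\<close> an isomorphism onto its image when it is injective on the carrier.\<close>

definition rack_image :: "('a \<Rightarrow> 'b) \<Rightarrow> 'a rack \<Rightarrow> 'b rack" where
  "rack_image j X =
     \<lparr>carrier = j ` carrier X,
      rack_op = (\<lambda>u v. j (inv_into (carrier X) j u \<triangleleft>\<^bsub>X\<^esub> inv_into (carrier X) j v)),
      rack_inv_op = (\<lambda>u v. j (inv_into (carrier X) j u \<triangleleft>\<^sup>-\<^bsub>X\<^esub> inv_into (carrier X) j v))\<rparr>"

lemma rack_image:
  assumes "rack X" "inj_on j (carrier X)"
  shows "rack (rack_image j X)"
    and "inv_into (carrier X) j \<in> rack_hom (rack_image j X) X"
    and "inv_into (carrier X) j ` carrier (rack_image j X) = carrier X"
proof -
  interpret X: rack X by fact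
  show "rack (rack_image j X)"
  proof
    fix x y z
    assume "x \<in> carrier (rack_image j X)" "y \<in> carrier (rack_image j X)"
      "z \<in> carrier (rack_image j X)"
    then show "x \<triangleleft>\<^bsub>rack_image j X\<^esub> y \<triangleleft>\<^bsub>rack_image j X\<^esub> z =
        x \<triangleleft>\<^bsub>rack_image j X\<^esub> z \<triangleleft>\<^bsub>rack_image j X\<^esub> (y \<triangleleft>\<^bsub>rack_image j X\<^esub> z)"
      by (auto simp: rack_image_def assms(2) X.op_closed intro!: arg_cong[of _ _ j] X.self_distrib)
  qed (auto simp: rack_image_def assms(2) X.op_closed X.inv_op_closed X.op_inv_op X.inv_op_op)
  show "inv_into (carrier X) j \<in> rack_hom (rack_image j X) X"
    by (rule rack_homI) (auto simp: rack_image_def assms(2) X.op_closed X.inv_op_closed)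
  show "inv_into (carrier X) j ` carrier (rack_image j X) = carrier X"
    by (simp add: rack_image_def assms(2) image_image)
qed

text \<open>A path in the pullback along the transported extension maps to a path in the original pullback,
  so fibres still meet each component at most once.\<close>

lemma central_extension_change_type:
  fixes E :: "'e rack" and j :: "'e \<Rightarrow> 'd"
  assumes "rack A" "rack_extension A B f" "rack E" "rack_extension E B e"
    and triv: "trivial_extension (rack_pullback E A e f) E fst"
    and inj: "inj_on j (carrier E)"
  shows "central_extension TYPE('d) A B f"
proof -
  let ?i = "inv_into (carrier E) j" and ?E' = "rack_image j E"
  note i = rack_image(2,3)[OF assms(3) inj]
  let ?e' = "\<lambda>y. e (?i y)"
  let ?P = "rack_pullback E A e f" and ?P' = "rack_pullback ?E' A ?e' f"
  have e': "rack_extension ?E' B ?e'"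
    using assms(4) rack_hom_comp[OF i(1), of e B] i(2)
    by (auto simp: rack_extension_def simp flip: image_image)
  have P: "(\<lambda>(y, a). (?i y, a)) \<in> rack_hom ?P' ?P"
    by (rule rack_homI) (auto simp: rack_homD[OF i(1)])
  have "a = b" if "(y, a) \<in> carrier ?P'" "(y, b) \<in> carrier ?P'"
    "eta ?P' (y, a) = eta ?P' (y, b)" for y a b
  proof -
    have "(?i y, a) \<in> carrier ?P" "(?i y, b) \<in> carrier ?P"
      "eta ?P (?i y, a) = eta ?P (?i y, b)"
      using rack_homD(1)[OF P that(1)] rack_homD(1)[OF P that(2)] rack_hom_eta_eq[OF P that]
      by simp_all
    with triv[unfolded trivial_extension_pullback_iff[OF assms(1,3,2,4)]] show ?thesis
      by blast
  qed
  then have "trivial_extension ?P' ?E' fst"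
    unfolding trivial_extension_pullback_iff[OF assms(1) rack_image(1)[OF assms(3) inj] assms(2) e']
    by blast
  then show ?thesis
    unfolding central_extension_def using assms(2) e' rack_image(1)[OF assms(3) inj] by blast
qed


section \<open>The rack of inner maps over a family of base points\<close>

text \<open>The group of inner automorphisms of \<open>X\<close>, generated by the maps \<open>x \<mapsto> x \<triangleleft> a\<close>. The maps are
  restricted to the carrier, so that equality of functions is equality on \<open>X\<close> and acting by \<open>a\<close> can be
  undone on the nose.\<close>

inductive_set inner_maps :: "'a rack \<Rightarrow> ('a \<Rightarrow> 'a) set" for X :: "'a rack" where
  ident: "(\<lambda>x\<in>carrier X. x) \<in> inner_maps X"
| op: "\<lbrakk>g \<in> inner_maps X; a \<in> carrier X\<rbrakk> \<Longrightarrow> (\<lambda>x\<in>carrier X. g x \<triangleleft>\<^bsub>X\<^esub> a) \<in> inner_maps X"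
| inv_op: "\<lbrakk>g \<in> inner_maps X; a \<in> carrier X\<rbrakk> \<Longrightarrow> (\<lambda>x\<in>carrier X. g x \<triangleleft>\<^sup>-\<^bsub>X\<^esub> a) \<in> inner_maps X"

lemma (in rack) inner_maps_bij_betw:
  assumes "g \<in> inner_maps X"
  shows "g \<in> extensional (carrier X)" "bij_betw g (carrier X) (carrier X)"
proof -
  have bij_op: "bij_betw (\<lambda>x. x \<triangleleft> a) (carrier X) (carrier X)"
    and bij_inv_op: "bij_betw (\<lambda>x. x \<triangleleft>\<^sup>- a) (carrier X) (carrier X)" if "a \<in> carrier X" for a
    by (rule bij_betw_byWitness[where f' = "\<lambda>x. x \<triangleleft>\<^sup>- a"]
          bij_betw_byWitness[where f' = "\<lambda>x. x \<triangleleft> a"];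
        use that in \<open>auto simp: op_closed inv_op_closed op_inv_op inv_op_op\<close>)+
  show "g \<in> extensional (carrier X)"
    using assms by cases auto
  show "bij_betw g (carrier X) (carrier X)"
    using assms
  proof induction
    case ident
    show ?case by (simp add: bij_betw_def inj_on_def)
  next
    case (op g a)
    then show ?case
      using bij_betw_trans[OF op(3) bij_op[OF op(2)]]
      by (simp add: bij_betw_restrict_eq comp_def del: restrict_apply)
  next
    case (inv_op g a)
    then show ?case
      using bij_betw_trans[OF inv_op(3) bij_inv_op[OF inv_op(2)]]
      by (simp add: bij_betw_restrict_eq comp_def del: restrict_apply)
  qed
qed

text \<open>The element \<open>(c, g)\<close> stands for the point \<open>g (\<sigma> c)\<close> together with a recorded way of reaching it
  from \<open>\<sigma> c\<close>; a pair acts on others through its point. Its analogue with elements of the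
  free group on \<open>S\<close> in place of the automorphisms \<open>g\<close> is the free rack on \<open>S\<close>.\<close>

definition inner_rack :: "'a rack \<Rightarrow> 's set \<Rightarrow> ('s \<Rightarrow> 'a) \<Rightarrow> ('s \<times> ('a \<Rightarrow> 'a)) rack" where
  "inner_rack X S \<sigma> =
     \<lparr>carrier = S \<times> inner_maps X,
      rack_op = (\<lambda>(c, g) (d, h). (c, \<lambda>x\<in>carrier X. g x \<triangleleft>\<^bsub>X\<^esub> h (\<sigma> d))),
      rack_inv_op = (\<lambda>(c, g) (d, h). (c, \<lambda>x\<in>carrier X. g x \<triangleleft>\<^sup>-\<^bsub>X\<^esub> h (\<sigma> d)))\<rparr>"

lemma inner_rack_simps [simp]:
  "(c, g) \<in> carrier (inner_rack X S \<sigma>) \<longleftrightarrow> c \<in> S \<and> g \<in> inner_maps X"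
  "(c, g) \<triangleleft>\<^bsub>inner_rack X S \<sigma>\<^esub> (d, h) = (c, \<lambda>x\<in>carrier X. g x \<triangleleft>\<^bsub>X\<^esub> h (\<sigma> d))"
  "(c, g) \<triangleleft>\<^sup>-\<^bsub>inner_rack X S \<sigma>\<^esub> (d, h) = (c, \<lambda>x\<in>carrier X. g x \<triangleleft>\<^sup>-\<^bsub>X\<^esub> h (\<sigma> d))"
  by (simp_all add: inner_rack_def)

context rack
begin

lemma inner_maps_closed: "g \<in> inner_maps X \<Longrightarrow> x \<in> carrier X \<Longrightarrow> g x \<in> carrier X"
  using inner_maps_bij_betw(2) by (auto simp: bij_betw_def)

text \<open>The conditions on the second components are the rack laws of \<open>X\<close>, applied pointwise.\<close>

lemma rack_inner_rack:
  assumes \<sigma>: "\<And>c. c \<in> S \<Longrightarrow> \<sigma> c \<in> carrier X"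
  shows "rack (inner_rack X S \<sigma>)"
proof -
  \<comment> \<open>Undoing an action returns \<open>g\<close> itself, off the carrier too, because inner maps are extensional.\<close>
  have eq: "(\<lambda>x\<in>carrier X. F x) = g"
    if "g \<in> inner_maps X" "\<And>x. x \<in> carrier X \<Longrightarrow> F x = g x" for F g
    using that inner_maps_bij_betw(1)[OF that(1)] by (intro extensionalityI[of _ "carrier X"]) auto
  show ?thesis
  proof
    fix x y z
    assume "x \<in> carrier (inner_rack X S \<sigma>)" "y \<in> carrier (inner_rack X S \<sigma>)"
      "z \<in> carrier (inner_rack X S \<sigma>)"
    moreover obtain c g d h e k where "x = (c, g)" "y = (d, h)" "z = (e, k)"
      by (metis surj_pair)
    ultimately have *: "x = (c, g)" "y = (d, h)" "z = (e, k)" "c \<in> S" "d \<in> S" "e \<in> S"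
      "g \<in> inner_maps X" "h \<in> inner_maps X" "k \<in> inner_maps X"
      by simp_all
    note cl = \<sigma> inner_maps_closed op_closed inv_op_closed
    show "x \<triangleleft>\<^bsub>inner_rack X S \<sigma>\<^esub> y \<in> carrier (inner_rack X S \<sigma>)"
      "x \<triangleleft>\<^sup>-\<^bsub>inner_rack X S \<sigma>\<^esub> y \<in> carrier (inner_rack X S \<sigma>)"
      using * by (simp_all add: inner_maps.op inner_maps.inv_op cl)
    show "(x \<triangleleft>\<^bsub>inner_rack X S \<sigma>\<^esub> y) \<triangleleft>\<^sup>-\<^bsub>inner_rack X S \<sigma>\<^esub> y = x"
      "(x \<triangleleft>\<^sup>-\<^bsub>inner_rack X S \<sigma>\<^esub> y) \<triangleleft>\<^bsub>inner_rack X S \<sigma>\<^esub> y = x"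
      using * by (simp_all add: eq op_inv_op inv_op_op cl)
    show "(x \<triangleleft>\<^bsub>inner_rack X S \<sigma>\<^esub> y) \<triangleleft>\<^bsub>inner_rack X S \<sigma>\<^esub> z =
        (x \<triangleleft>\<^bsub>inner_rack X S \<sigma>\<^esub> z) \<triangleleft>\<^bsub>inner_rack X S \<sigma>\<^esub> (y \<triangleleft>\<^bsub>inner_rack X S \<sigma>\<^esub> z)"
      using * by (simp add: cl) (intro restrict_ext, simp, intro self_distrib; simp add: cl)
  qed
qed

lemma inner_rack_eval_rack_hom:
  assumes \<sigma>: "\<And>c. c \<in> S \<Longrightarrow> \<sigma> c \<in> carrier X"
  shows "(\<lambda>(c, g). g (\<sigma> c)) \<in> rack_hom (inner_rack X S \<sigma>) X"
  by (rule rack_homI) (auto simp: \<sigma> inner_maps_closed)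

end


section \<open>Coverings are split by the rack of inner maps\<close>

text \<open>This symmetric form of the covering condition is the one that is used below: the action of an
  element depends only on its image in \<open>B\<close>.\<close>

lemma rack_covering_op_cong:
  assumes "rack A" "rack_covering A B f"
    and "x \<in> carrier A" "a \<in> carrier A" "b \<in> carrier A" "f a = f b"
  shows "x \<triangleleft>\<^bsub>A\<^esub> a = x \<triangleleft>\<^bsub>A\<^esub> b" "x \<triangleleft>\<^sup>-\<^bsub>A\<^esub> a = x \<triangleleft>\<^sup>-\<^bsub>A\<^esub> b"
proof -
  interpret A: rack A by fact
  have *: "y \<triangleleft>\<^bsub>A\<^esub> a = y \<triangleleft>\<^bsub>A\<^esub> b" if "y \<in> carrier A" for y
    using assms that A.inv_op_op[of "y \<triangleleft>\<^bsub>A\<^esub> a" b] by (simp add: rack_covering_def A.op_closed)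
  show "x \<triangleleft>\<^bsub>A\<^esub> a = x \<triangleleft>\<^bsub>A\<^esub> b"
    using * assms(3) .
  show "x \<triangleleft>\<^sup>-\<^bsub>A\<^esub> a = x \<triangleleft>\<^sup>-\<^bsub>A\<^esub> b"
    using *[of "x \<triangleleft>\<^sup>-\<^bsub>A\<^esub> a"] assms A.op_inv_op[of "x \<triangleleft>\<^sup>-\<^bsub>A\<^esub> a" b]
    by (simp add: A.inv_op_closed A.inv_op_op)
qed

text \<open>An element \<open>((c, g), a)\<close> of the pullback satisfies \<open>f (g (\<sigma> c)) = f a\<close>. The function
  \<open>\<Phi> ((c, g), a) = g\<^sup>-\<^sup>1 a\<close> is constant on components: acting by \<open>((d, h), b)\<close> moves \<open>g\<close> by \<open>h (\<sigma> d)\<close> and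
  \<open>a\<close> by \<open>b\<close>, and these act equally since they lie in one fibre of the covering. As \<open>g\<close> is injective,
  \<open>\<Phi>\<close> tells apart the elements of the pullback over a given \<open>(c, g)\<close>, so distinct ones lie in distinct
  components.\<close>

lemma rack_covering_split_by_inner_rack:
  assumes "rack A" and cov: "rack_covering A B f"
    and \<sigma>: "\<And>c. c \<in> carrier B \<Longrightarrow> \<sigma> c \<in> carrier A" "\<And>c. c \<in> carrier B \<Longrightarrow> f (\<sigma> c) = c"
  defines "E \<equiv> inner_rack A (carrier B) \<sigma>" and "e \<equiv> \<lambda>(c, g). f (g (\<sigma> c))"
  shows "rack_extension E B e" "trivial_extension (rack_pullback E A e f) E fst"
proof -
  interpret A: rack A by fact
  have f: "rack_extension A B f"
    using cov by (simp add: rack_covering_def)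
  have E: "rack E"
    unfolding E_def by (rule A.rack_inner_rack[OF \<sigma>(1)])
  show e: "rack_extension E B e"
    unfolding rack_extension_def
  proof
    show hom: "e \<in> rack_hom E B"
      using rack_hom_comp[OF A.inner_rack_eval_rack_hom[of "carrier B" \<sigma>], of f B] f \<sigma>(1)
      by (simp add: E_def e_def rack_extension_def case_prod_unfold)
    have "e (c, \<lambda>x\<in>carrier A. x) = c" "(c, \<lambda>x\<in>carrier A. x) \<in> carrier E" if "c \<in> carrier B" for c
      using that \<sigma> inner_maps.ident by (simp_all add: E_def e_def)
    then show "e ` carrier E = carrier B"
      using rack_homD(1)[OF hom] by (auto simp: image_iff) metis
  qed
  let ?P = "rack_pullback E A e f"
  let ?\<Phi> = "\<lambda>((c, g), a). inv_into (carrier A) g a"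
  have inv: "?\<Phi> (p \<triangleleft>\<^bsub>?P\<^esub> q) = ?\<Phi> p" if "p \<in> carrier ?P" "q \<in> carrier ?P" for p q
  proof -
    obtain c g a d h b where pq: "p = ((c, g), a)" "q = ((d, h), b)"
      by (metis surj_pair)
    have g: "g \<in> inner_maps A" and h: "h \<in> inner_maps A" and mem: "c \<in> carrier B" "d \<in> carrier B"
      "a \<in> carrier A" "b \<in> carrier A" "f (h (\<sigma> d)) = f b"
      using that by (auto simp: pq E_def e_def)
    have bij: "bij_betw g (carrier A) (carrier A)"
      by (rule A.inner_maps_bij_betw(2)[OF g])
    define z where "z = inv_into (carrier A) g a"
    have z: "z \<in> carrier A" "g z = a"
      using bij mem(3) by (auto simp: z_def bij_betw_def inv_into_into f_inv_into_f)
    have k: "(\<lambda>x\<in>carrier A. g x \<triangleleft>\<^bsub>A\<^esub> h (\<sigma> d)) \<in> inner_maps A"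
      using g h mem \<sigma>(1) by (intro inner_maps.op) (auto simp: A.inner_maps_closed)
    have "a \<triangleleft>\<^bsub>A\<^esub> b = (\<lambda>x\<in>carrier A. g x \<triangleleft>\<^bsub>A\<^esub> h (\<sigma> d)) z"
      using rack_covering_op_cong(1)[OF assms(1) cov mem(3) _ mem(4) mem(5)] h mem \<sigma>(1) z
      by (simp add: A.inner_maps_closed)
    then have "inv_into (carrier A) (\<lambda>x\<in>carrier A. g x \<triangleleft>\<^bsub>A\<^esub> h (\<sigma> d)) (a \<triangleleft>\<^bsub>A\<^esub> b) = z"
      using A.inner_maps_bij_betw(2)[OF k] z(1) by (simp only: bij_betw_def inv_into_f_f)
    then show ?thesis
      by (simp add: pq E_def z_def)
  qed
  have const: "?\<Phi> p = ?\<Phi> q" if "(p, q) \<in> component_rel ?P" for p q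
    using that by (induction rule: component_rel_induct) (simp_all only: inv)
  have "a = b" if "(y, a) \<in> carrier ?P" "(y, b) \<in> carrier ?P" "eta ?P (y, a) = eta ?P (y, b)"
    for y a b
  proof -
    obtain c g where y: "y = (c, g)"
      by force
    have "inv_into (carrier A) g a = inv_into (carrier A) g b"
      using const[of "(y, a)" "(y, b)"] that(3) eta_eq_iff[OF that(1,2)] y by simp
    moreover have "bij_betw g (carrier A) (carrier A)"
      using that(1) y by (simp add: E_def A.inner_maps_bij_betw)
    ultimately show ?thesis
      using that by (metis bij_betw_def f_inv_into_f rack_pullback_simps(1))
  qed
  then show "trivial_extension ?P E fst"
    unfolding trivial_extension_pullback_iff[OF assms(1) E f e] by blast
qed


section \<open>Words for inner maps\<close>

text \<open>The letter \<open>(s, d)\<close> acts by \<open>\<sigma> d\<close>, directly or inversely according to the sign \<open>s\<close>; the head of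
  the list acts last.\<close>

fun word_map :: "'a rack \<Rightarrow> ('b \<Rightarrow> 'a) \<Rightarrow> (bool \<times> 'b) list \<Rightarrow> 'a \<Rightarrow> 'a" where
  "word_map X \<sigma> [] = (\<lambda>x\<in>carrier X. x)"
| "word_map X \<sigma> ((s, d) # w) =
     (\<lambda>x\<in>carrier X. if s then word_map X \<sigma> w x \<triangleleft>\<^bsub>X\<^esub> \<sigma> d else word_map X \<sigma> w x \<triangleleft>\<^sup>-\<^bsub>X\<^esub> \<sigma> d)"

text \<open>In a covering, \<open>a\<close> acts as \<open>\<sigma> (f a)\<close>, so the chosen representatives generate all inner
  automorphisms.\<close>

lemma rack_covering_inner_maps_words:
  assumes "rack A" and cov: "rack_covering A B f"
    and \<sigma>: "\<And>c. c \<in> carrier B \<Longrightarrow> \<sigma> c \<in> carrier A" "\<And>c. c \<in> carrier B \<Longrightarrow> f (\<sigma> c) = c"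
  shows "inner_maps A \<subseteq> range (word_map A \<sigma>)"
proof
  interpret A: rack A by fact
  have \<sigma>f: "\<sigma> (f a) \<in> carrier A" "f a = f (\<sigma> (f a))" if "a \<in> carrier A" for a
    using that \<sigma> cov rack_homD(1)[of f A B a] by (simp_all add: rack_covering_def rack_extension_def)
  fix g assume "g \<in> inner_maps A"
  then show "g \<in> range (word_map A \<sigma>)"
  proof induction
    case ident
    show ?case by (rule range_eqI[of _ _ "[]"]) simp
  next
    case (op g a)
    then obtain w where w: "g = word_map A \<sigma> w" by blast
    have "(\<lambda>x\<in>carrier A. g x \<triangleleft>\<^bsub>A\<^esub> a) = word_map A \<sigma> ((True, f a) # w)"
      using op rack_covering_op_cong(1)[OF assms(1) cov _ op(2) \<sigma>f[OF op(2)]]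
      by (auto simp: A.inner_maps_closed simp flip: w intro: restrict_ext)
    then show ?case by blast
  next
    case (inv_op g a)
    then obtain w where w: "g = word_map A \<sigma> w" by blast
    have "(\<lambda>x\<in>carrier A. g x \<triangleleft>\<^sup>-\<^bsub>A\<^esub> a) = word_map A \<sigma> ((False, f a) # w)"
      using inv_op rack_covering_op_cong(2)[OF assms(1) cov _ inv_op(2) \<sigma>f[OF inv_op(2)]]
      by (auto simp: A.inner_maps_closed simp flip: w intro: restrict_ext)
    then show ?case by blast
  qed
qed

text \<open>Signed words must be encoded by unsigned ones even over an alphabet with a single letter, where
  a list carries no information except its length. So the letters are kept in place and the signs,
  together with the length of the word, are stored in the length of the padded list.\<close>

definition word_code :: "(bool \<times> 'b) list \<Rightarrow> 'b list" where
  "word_code w = map snd w @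
     replicate (prod_encode (length w, to_nat (map fst w)) - length w) undefined"

lemma inj_word_code: "inj (word_code :: (bool \<times> 'b) list \<Rightarrow> 'b list)"
proof (rule injI)
  fix v w :: "(bool \<times> 'b) list"
  assume eq: "word_code v = word_code w"
  have len: "length (word_code u) = prod_encode (length u, to_nat (map fst u))" for u :: "(bool \<times> 'b) list"
    using le_prod_encode_1[of "length u"] by (simp add: word_code_def)
  have "length v = length w" "map fst v = map fst w"
    using arg_cong[OF eq, of length] unfolding len by (auto dest: injD[OF inj_prod_encode])
  moreover from this have "map snd v = map snd w"
    using eq by (simp add: word_code_def)
  ultimately show "v = w"
    by (metis zip_map_fst_snd)
qed

lemma rack_covering_imp_central_extension:
  assumes "rack A" "rack_covering A B f"
  shows "central_extension TYPE('b list) A (B :: 'b rack) f"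
proof -
  interpret A: rack A by fact
  have f: "rack_extension A B f"
    using assms(2) by (simp add: rack_covering_def)
  define \<sigma> where "\<sigma> = inv_into (carrier A) f"
  have \<sigma>: "\<sigma> c \<in> carrier A" "f (\<sigma> c) = c" if "c \<in> carrier B" for c
    using f that unfolding rack_extension_def \<sigma>_def by (auto simp: inv_into_into f_inv_into_f)
  let ?E = "inner_rack A (carrier B) \<sigma>"
  \<comment> \<open>The base point becomes the head of the list, followed by the code of a chosen word for \<open>g\<close>.\<close>
  let ?j = "\<lambda>(c, g). c # word_code (inv (word_map A \<sigma>) g)"
  note words = rack_covering_inner_maps_words[OF assms \<sigma>]
  have "inj_on ?j (carrier ?E)"
  proof (rule inj_onI)
    fix p q assume pq: "p \<in> carrier ?E" "q \<in> carrier ?E" "?j p = ?j q"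
    obtain c g d h where "p = (c, g)" "q = (d, h)"
      by (metis surj_pair)
    moreover from this pq have "inv (word_map A \<sigma>) g = inv (word_map A \<sigma>) h"
      by (auto dest: injD[OF inj_word_code])
    moreover from calculation pq words have "g = h"
      by (auto dest!: inv_into_injective)
    ultimately show "p = q"
      using pq by simp
  qed
  then show ?thesis
    using central_extension_change_type[OF assms(1) f A.rack_inner_rack[OF \<sigma>(1)]
      rack_covering_split_by_inner_rack[OF assms \<sigma>]] by blast
qed

theorem theorem3p2p0p1:
  fixes A :: "'a rack" and B :: "'b rack" and f :: "'a \<Rightarrow> 'b"
  assumes "rack A" and "rack B" and "rack_extension A B f"
  shows "(rack_covering A B f \<longleftrightarrow> central_extension TYPE('b list) A B f) \<and>
         (central_extension TYPE('e) A B f \<longrightarrow> rack_covering A B f)"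
  using rack_covering_imp_central_extension[OF assms(1), of B f]
    central_extension_imp_rack_covering[OF assms(1), where 'e = "'b list", of B f]
    central_extension_imp_rack_covering[OF assms(1), where 'e = 'e, of B f]
  by blast

end
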